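(* For all integers $n\geq 0$ and $k\geq 0$, all primes $p\geq 5$, and all quadratic nonresidues $r$ modulo $p$ with $1\leq r\leq p-1$, $$\overline{OPT}_{2k+1}(2pn+R)\equiv 0 \pmod 4,$$ where $$R=\begin{cases} r, & \text{if } r \text{ is odd},\\ p+r, & \text{if } r \text{ is even}.\end{cases}$$
   Context: An overpartition of a nonnegative integer $n$ is a non-increasing sequence of positive integers with sum $n$ in which the first occurrence of each number may be overlined. For an integer $k\geq 1$, an overpartition $k$-tuple of $n$ with odd parts is an (ordered) $k$-tuple $(\xi_1,\ldots,\xi_k)$ of overpartitions, all of whose parts are odd, such that the sum of all the parts of $\xi_1,\ldots,\xi_k$ is $n$. $\overline{OPT}_k(n)$ denotes the number of overpartition $k$-tuples of $n$ with odd parts. Its generating function is $$\sum_{n\geq 0}\overline{OPT}_k(n)q^n=\frac{f_2^{3k}}{f_1^{2k}f_4^k}=\prod_{i\geq 0}\left(\frac{1+q^{2i+1}}{1-q^{2i+1}}\right)^k,\qquad f_j:=\prod_{i\geq 1}(1-q^{ji}).$$ *)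

theory Defs
  imports "HOL-Number_Theory.Number_Theory"
begin

(* A part is a pair of its size and a flag telling whether it is overlined. *)

type_synonym part = "nat \<times> bool"

definition overpartition :: "part list \<Rightarrow> bool" where
  "overpartition xs \<longleftrightarrow>
     sorted_wrt (\<ge>) (map fst xs) \<and>
     (\<forall>x\<in>set xs. fst x > 0) \<and>
     (\<forall>i<length xs. snd (xs ! i) \<longrightarrow> (\<forall>j<i. fst (xs ! j) \<noteq> fst (xs ! i)))"

definition opt_tuples :: "nat \<Rightarrow> nat \<Rightarrow> part list list set" where
  "opt_tuples k n =
     {\<xi>s. length \<xi>s = k \<and>
          (\<forall>\<xi>\<in>set \<xi>s. overpartition \<xi> \<and> (\<forall>x\<in>set \<xi>. odd (fst x))) \<and>
          (\<Sum>\<xi>\<leftarrow>\<xi>s. \<Sum>x\<leftarrow>\<xi>. fst x) = n}"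

definition OPT :: "nat \<Rightarrow> nat \<Rightarrow> nat" where
  "OPT k n = card (opt_tuples k n)"

(* The set being counted is finite, so that card is not the default value 0. *)

lemma finite_opt_tuples: "finite (opt_tuples k n)"
proof -
  define A :: "part set" where "A = {..n} \<times> UNIV"
  define B where "B = {\<xi>. set \<xi> \<subseteq> A \<and> length \<xi> \<le> n}"
  have "finite B"
    unfolding B_def A_def by (intro finite_lists_length_le finite_cartesian_product) auto
  have "set \<xi>s \<subseteq> B" if "\<xi>s \<in> opt_tuples k n" for \<xi>s
  proof
    fix \<xi> assume mem: "\<xi> \<in> set \<xi>s"
    have "(\<Sum>x\<leftarrow>\<xi>. fst x) \<le> (\<Sum>\<xi>\<leftarrow>\<xi>s. \<Sum>x\<leftarrow>\<xi>. fst x)"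
      using mem by (intro member_le_sum_list) auto
    then have le: "(\<Sum>x\<leftarrow>\<xi>. fst x) \<le> n"
      using that by (simp add: opt_tuples_def)
    have pos: "\<forall>x\<in>set \<xi>. fst x > 0"
      using that mem by (auto simp: opt_tuples_def overpartition_def)
    have "length ys \<le> (\<Sum>x\<leftarrow>ys. fst x)" if "\<forall>x\<in>set ys. fst x > 0" for ys :: "part list"
      using that by (induction ys) auto
    then have "length \<xi> \<le> n"
      using pos le order_trans by blast
    moreover have "fst x \<le> n" if "x \<in> set \<xi>" for x
      using le member_le_sum_list[of "fst x" "map fst \<xi>"] that by auto
    ultimately show "\<xi> \<in> B"
      by (auto simp: B_def A_def)
  qed
  then have "opt_tuples k n \<subseteq> {\<xi>s. set \<xi>s \<subseteq> B \<and> length \<xi>s = k}"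
    by (auto simp: opt_tuples_def)
  then show ?thesis
    using finite_lists_length_eq[OF \<open>finite B\<close>, of k] finite_subset by blast
qed

end

theory Submission
  imports Defs "HOL-Computational_Algebra.Formal_Power_Series"
begin

text \<open>
  Choosing which part sizes to overline, the number of overpartitions of \<open>n\<close> into odd parts is the
  sum of \<open>2 ^ d(\<lambda>)\<close> over the partitions \<open>\<lambda>\<close> of \<open>n\<close> into odd parts, where \<open>d(\<lambda>)\<close> is the number of
  distinct part sizes. Hence the generating function has the form \<open>G = 1 + 2 H\<close> with \<open>H\<close> integral,
  so \<open>G\<^sup>2 = 1 + 4 (H + H\<^sup>2)\<close> and \<open>G ^ (2 k + 1)\<close> is congruent to \<open>G\<close> modulo 4. Modulo 4, only partitions
  with a single part size contribute to \<open>G\<close>, so for odd \<open>n\<close> the coefficient of \<open>G\<close> is twice the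
  number of divisors of \<open>n\<close>. That number is even unless \<open>n\<close> is a square, and \<open>2 p n + R\<close>
  is not a square, being congruent to \<open>r\<close> modulo \<open>p\<close>.
\<close>

definition odd_partitions :: "nat \<Rightarrow> nat list set" where
  "odd_partitions n = {ys. sorted_wrt (\<ge>) ys \<and> (\<forall>y\<in>set ys. odd y) \<and> sum_list ys = n}"

definition odd_overpartitions :: "nat \<Rightarrow> part list set" where
  "odd_overpartitions n =
     {\<xi>. overpartition \<xi> \<and> (\<forall>x\<in>set \<xi>. odd (fst x)) \<and> (\<Sum>x\<leftarrow>\<xi>. fst x) = n}"

text \<open>Only the overlining clause of \<open>overpartition\<close> is kept, so that induction
  can run over arbitrary lists.\<close>

definition overlinings :: "'a list \<Rightarrow> ('a \<times> bool) list set" where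
  "overlinings ys =
     {xs. map fst xs = ys \<and>
          (\<forall>i<length xs. snd (xs ! i) \<longrightarrow> (\<forall>j<i. fst (xs ! j) \<noteq> fst (xs ! i)))}"

subsection \<open>Counting overlinings\<close>

lemma overlinings_Nil: "overlinings [] = {[]}"
  by (auto simp: overlinings_def)

text \<open>The overlining condition at an index looks only at earlier entries. Appending at the end
  therefore leaves the conditions on \<open>xs\<close> intact, and the new entry may be overlined
  only if its size is new.\<close>

lemma overlinings_snoc:
  "overlinings (ys @ [y]) =
     (\<lambda>(xs, b). xs @ [(y, b)]) ` (overlinings ys \<times> {b. b \<longrightarrow> y \<notin> set ys})"
proof (intro equalityI subsetI)
  fix zs assume zs: "zs \<in> overlinings (ys @ [y])"
  then have "map fst zs = ys @ [y]"
    by (simp add: overlinings_def)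
  then obtain xs b where zs_eq: "zs = xs @ [(y, b)]" and ys: "map fst xs = ys"
    by (auto simp: map_eq_append_conv)
  have *: "\<forall>j<i. fst (zs ! j) \<noteq> fst (zs ! i)" if "i < length zs" "snd (zs ! i)" for i
    using zs that by (auto simp: overlinings_def)
  have "\<forall>j<i. fst (xs ! j) \<noteq> fst (xs ! i)" if "i < length xs" "snd (xs ! i)" for i
    using *[of i] that by (auto simp: zs_eq nth_append)
  then have "xs \<in> overlinings ys"
    using ys by (auto simp: overlinings_def)
  moreover have "y \<notin> set ys" if b
    using *[of "length xs"] that ys by (auto simp: zs_eq nth_append in_set_conv_nth)
  ultimately show "zs \<in> (\<lambda>(xs, b). xs @ [(y, b)]) ` (overlinings ys \<times> {b. b \<longrightarrow> y \<notin> set ys})"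
    using zs_eq by auto
next
  fix zs assume "zs \<in> (\<lambda>(xs, b). xs @ [(y, b)]) ` (overlinings ys \<times> {b. b \<longrightarrow> y \<notin> set ys})"
  then obtain xs b where zs_eq: "zs = xs @ [(y, b)]" and xs: "xs \<in> overlinings ys"
    and b: "b \<longrightarrow> y \<notin> set ys"
    by auto
  then have ys: "ys = map fst xs"
    by (simp add: overlinings_def)
  have "y \<noteq> fst (xs ! j)" if b "j < length xs" for j
    using that b ys by (metis length_map nth_map nth_mem)
  then show "zs \<in> overlinings (ys @ [y])"
    using xs ys by (force simp: overlinings_def zs_eq nth_append less_Suc_eq)
qed

text \<open>Reading from the left, each new size doubles the count and each repetition preserves
  it.\<close>

lemma card_overlinings: "card (overlinings ys) = 2 ^ card (set ys)"
proof (induction ys rule: rev_induct)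
  case Nil
  show ?case by (simp add: overlinings_Nil)
next
  case (snoc y ys)
  have "inj_on (\<lambda>(xs, b). xs @ [(y, b)]) (overlinings ys \<times> {b. b \<longrightarrow> y \<notin> set ys})"
    by (auto intro!: inj_onI)
  then have "card (overlinings (ys @ [y])) = card (overlinings ys) * card {b. b \<longrightarrow> y \<notin> set ys}"
    by (simp add: overlinings_snoc card_image card_cartesian_product)
  moreover have "{b. b \<longrightarrow> y \<notin> set ys} = (if y \<in> set ys then {False} else UNIV)"
    by auto
  ultimately show ?case
    by (simp add: snoc.IH insert_absorb)
qed

lemma finite_overlinings: "finite (overlinings ys)"
  \<comment> \<open>An infinite set would have \<open>card\<close> 0, not a power of 2.\<close>
  by (rule card_ge_0_finite) (simp add: card_overlinings)

section \<open>Overpartitions with odd parts, grouped by underlying partition\<close>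

lemma odd_overpartitions_eq: "odd_overpartitions n = (\<Union>ys\<in>odd_partitions n. overlinings ys)"
proof (rule Set.set_eqI)
  fix \<xi>
  have "\<xi> \<in> (\<Union>ys\<in>odd_partitions n. overlinings ys) \<longleftrightarrow>
      map fst \<xi> \<in> odd_partitions n \<and> \<xi> \<in> overlinings (map fst \<xi>)"
    unfolding overlinings_def by blast
  also have "\<dots> \<longleftrightarrow> \<xi> \<in> odd_overpartitions n"
    unfolding odd_overpartitions_def odd_partitions_def overlinings_def overpartition_def
    \<comment> \<open>\<open>odd_pos\<close> supplies the positivity clause of
      \<open>overpartition\<close>, which \<open>odd_partitions\<close> does not state.\<close>
    by (simp, use odd_pos in blast)
  finally show "\<xi> \<in> odd_overpartitions n \<longleftrightarrow> \<xi> \<in> (\<Union>ys\<in>odd_partitions n. overlinings ys)" ..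
qed

lemma finite_odd_partitions: "finite (odd_partitions n)"
proof -
  have "length ys \<le> sum_list ys" if "\<forall>y\<in>set ys. odd y" for ys :: "nat list"
    using that by (induction ys) (auto dest: odd_pos)
  moreover have "set ys \<subseteq> {..sum_list ys}" for ys :: "nat list"
    using member_le_sum_list[of _ ys] by auto
  ultimately have "odd_partitions n \<subseteq> {ys. set ys \<subseteq> {..n} \<and> length ys \<le> n}"
    by (force simp: odd_partitions_def)
  then show ?thesis
    using finite_lists_length_le[of "{..n}" n] finite_subset by auto
qed

lemma finite_odd_overpartitions: "finite (odd_overpartitions n)"
  by (simp add: odd_overpartitions_eq finite_odd_partitions finite_overlinings)

lemma card_odd_overpartitions:
  "card (odd_overpartitions n) = (\<Sum>ys\<in>odd_partitions n. 2 ^ card (set ys))"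
proof -
  have "card (odd_overpartitions n) = (\<Sum>ys\<in>odd_partitions n. card (overlinings ys))"
    unfolding odd_overpartitions_eq
    \<comment> \<open>The union is disjoint because \<open>map fst\<close> recovers the underlying
      partition.\<close>
    by (rule card_UN_disjoint)
      (auto simp: finite_odd_partitions finite_overlinings, auto simp: overlinings_def)
  then show ?thesis by (simp add: card_overlinings)
qed

lemma card_odd_overpartitions_0: "card (odd_overpartitions 0) = 1"
proof -
  have "ys = []" if "ys \<in> odd_partitions 0" for ys
    using that by (cases ys) (simp_all add: odd_partitions_def)
  then have "odd_partitions 0 = {[]}"
    by (auto simp: odd_partitions_def)
  then show ?thesis by (simp add: card_odd_overpartitions)
qed

lemma odd_partitions_nonempty_set:
  assumes "ys \<in> odd_partitions n" "n > 0"
  shows "card (set ys) > 0"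
proof -
  have "ys \<noteq> []"
    using assms by (auto simp: odd_partitions_def)
  then show ?thesis
    by (simp add: card_gt_0_iff)
qed

lemma even_card_odd_overpartitions:
  assumes "n > 0"
  shows "even (card (odd_overpartitions n))"
  unfolding card_odd_overpartitions
proof (rule dvd_sum)
  fix ys assume "ys \<in> odd_partitions n"
  then show "2 dvd (2::nat) ^ card (set ys)"
    using odd_partitions_nonempty_set assms by simp
qed

subsection \<open>Partitions with a single part size\<close>

text \<open>The size \<open>d\<close> forces the multiplicity \<open>n div d\<close>; as
  \<open>n\<close> is odd, each of its divisors is an admissible size.\<close>

lemma odd_partitions_single_size:
  assumes "odd n"
  shows "{ys \<in> odd_partitions n. card (set ys) = 1} = (\<lambda>d. replicate (n div d) d) ` {d. d dvd n}"
    (is "?L = ?R")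
proof (intro equalityI subsetI)
  fix ys assume ys: "ys \<in> ?L"
  then obtain d where d: "set ys = {d}"
    by (auto simp: card_1_singleton_iff)
  then have rep: "ys = replicate (length ys) d"
    using replicate_length_same[of ys d] by auto
  then have "n = length ys * d"
    using ys by (metis (mono_tags, lifting) mem_Collect_eq odd_partitions_def sum_list_replicate of_nat_id)
  moreover from this have "d > 0"
    using assms by (cases d) auto
  ultimately show "ys \<in> ?R"
    using rep by (intro image_eqI[where x = d]) auto
next
  fix ys assume "ys \<in> ?R"
  then obtain d where d: "d dvd n" and ys: "ys = replicate (n div d) d"
    by auto
  then have "odd d" "n div d > 0"
    using assms by (auto simp: dvd_div_eq_0_iff intro: dvd_trans)
  moreover have "sorted_wrt (\<ge>) (replicate m d)" for m
    by (induction m) auto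
  ultimately show "ys \<in> ?L"
    using d by (auto simp: ys odd_partitions_def sum_list_replicate)
qed

lemma card_odd_partitions_single_size:
  assumes "odd n"
  shows "card {ys \<in> odd_partitions n. card (set ys) = 1} = card {d. d dvd n}"
proof -
  have "inj_on (\<lambda>d. replicate (n div d) d) {d. d dvd n}"
  proof (rule inj_onI)
    fix d e assume "d \<in> {d. d dvd n}" "e \<in> {d. d dvd n}"
      and eq: "replicate (n div d) d = replicate (n div e) e"
    \<comment> \<open>The lists are nonempty, so their common entry determines
      \<open>d\<close>.\<close>
    then have "n div d \<noteq> 0"
      using assms by (auto simp: dvd_div_eq_0_iff intro: odd_pos)
    then show "d = e"
      using eq by (auto simp: replicate_eq_replicate)
  qed
  then show ?thesis
    by (simp only: odd_partitions_single_size[OF assms] card_image)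
qed

text \<open>Partitions with at least two sizes contribute multiples of 4, those with one size
  contribute 2 each.\<close>

lemma card_odd_overpartitions_cong:
  assumes "odd n"
  shows "[card (odd_overpartitions n) = 2 * card {d. d dvd n}] (mod 4)"
proof -
  let ?A = "{ys \<in> odd_partitions n. card (set ys) = 1}"
  have "4 dvd (\<Sum>ys\<in>odd_partitions n - ?A. 2 ^ card (set ys) :: nat)"
  proof (rule dvd_sum)
    fix ys assume ys: "ys \<in> odd_partitions n - ?A"
    then have "card (set ys) > 0"
      using assms by (auto intro!: odd_partitions_nonempty_set intro: odd_pos)
    then have "2 \<le> card (set ys)"
      using ys by auto
    then have "(2::nat) ^ 2 dvd 2 ^ card (set ys)"
      by (rule le_imp_power_dvd)
    then show "4 dvd (2::nat) ^ card (set ys)"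
      by simp
  qed
  moreover have "card (odd_overpartitions n) =
      (\<Sum>ys\<in>odd_partitions n - ?A. 2 ^ card (set ys)) + (\<Sum>ys\<in>?A. 2 ^ card (set ys))"
    unfolding card_odd_overpartitions
    by (rule sum.subset_diff) (auto simp: finite_odd_partitions)
  moreover have "(\<Sum>ys\<in>?A. 2 ^ card (set ys)) = 2 * card {d. d dvd n}"
    using card_odd_partitions_single_size[OF assms] by simp
  ultimately show ?thesis
    by (auto simp: cong_def mult.commute elim!: dvdE)
qed

text \<open>The map from \<open>d\<close> to \<open>n div d\<close> pairs the divisors below the
  square root of \<open>n\<close> with those above it, and no divisor lies on it.\<close>

lemma even_card_divisors:
  fixes n :: nat
  assumes "\<And>m. n \<noteq> m ^ 2"
  shows "even (card {d. d dvd n})"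
proof -
  \<comment> \<open>This excludes 0, which every number divides, so that the set of divisors is
    finite.\<close>
  have n: "n > 0"
    using assms[of 0] by simp
  let ?A = "{d. d dvd n \<and> d * d < n}" and ?B = "{d. d dvd n \<and> n < d * d}"
  have fin: "finite {d. d dvd n}"
    using n by simp
  have swap: "d * d < n \<longleftrightarrow> n < (n div d) * (n div d)" "n < d * d \<longleftrightarrow> (n div d) * (n div d) < n"
    if dvd: "d dvd n" for d
  proof -
    obtain e where e: "n = d * e" using dvd ..
    then have "d > 0" "e > 0" using n by auto
    then show "d * d < n \<longleftrightarrow> n < (n div d) * (n div d)" "n < d * d \<longleftrightarrow> (n div d) * (n div d) < n"
      by (simp_all add: e)
  qed
  have "bij_betw (\<lambda>d. n div d) ?A ?B"
    by (rule bij_betwI[where g = "\<lambda>d. n div d"]) (use n swap in auto)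
  then have "card ?A = card ?B"
    by (rule bij_betw_same_card)
  moreover have "{d. d dvd n} = ?A \<union> ?B"
    using assms by (auto simp: power2_eq_square neq_iff)
  moreover have "card (?A \<union> ?B) = card ?A + card ?B"
    using fin by (intro card_Un_disjoint) (auto intro: finite_subset[OF _ fin])
  ultimately have "card {d. d dvd n} = card ?B + card ?B"
    by argo
  then show ?thesis
    by (simp only: even_add)
qed

subsection \<open>The generating function\<close>

lemma OPT_0: "OPT 0 n = (if n = 0 then 1 else 0)"
proof -
  have "opt_tuples 0 n = (if n = 0 then {[]} else {})"
    by (auto simp: opt_tuples_def)
  then show ?thesis
    by (simp add: OPT_def)
qed

text \<open>Splitting off the first overpartition of a tuple gives a Cauchy product, hence the
  powers in \<open>OPT_gf\<close>.\<close>

lemma OPT_Suc: "OPT (Suc k) n = (\<Sum>i=0..n. card (odd_overpartitions i) * OPT k (n - i))"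
proof -
  let ?S = "\<lambda>i. odd_overpartitions i \<times> opt_tuples k (n - i)"
  have "opt_tuples (Suc k) n = (\<lambda>(\<xi>, \<xi>s). \<xi> # \<xi>s) ` (\<Union>i\<in>{0..n}. ?S i)"
  proof (intro equalityI subsetI)
    fix \<zeta> assume \<zeta>: "\<zeta> \<in> opt_tuples (Suc k) n"
    then obtain \<xi> \<xi>s where eq: "\<zeta> = \<xi> # \<xi>s"
      unfolding opt_tuples_def by (cases \<zeta>) simp_all
    define s where "s = (\<Sum>x\<leftarrow>\<xi>. fst x)"
    have "\<xi> \<in> odd_overpartitions s" "s \<le> n" "\<xi>s \<in> opt_tuples k (n - s)"
      using \<zeta> unfolding eq s_def opt_tuples_def odd_overpartitions_def
      by (simp_all, metis add_diff_cancel_left')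
    then show "\<zeta> \<in> (\<lambda>(\<xi>, \<xi>s). \<xi> # \<xi>s) ` (\<Union>i\<in>{0..n}. ?S i)"
      by (intro image_eqI[where x = "(\<xi>, \<xi>s)"]) (auto simp: eq)
  next
    fix \<zeta> assume "\<zeta> \<in> (\<lambda>(\<xi>, \<xi>s). \<xi> # \<xi>s) ` (\<Union>i\<in>{0..n}. ?S i)"
    then obtain i \<xi> \<xi>s where "\<zeta> = \<xi> # \<xi>s" "i \<le> n"
      and "\<xi> \<in> odd_overpartitions i" "\<xi>s \<in> opt_tuples k (n - i)"
      by auto
    then show "\<zeta> \<in> opt_tuples (Suc k) n"
      by (simp add: opt_tuples_def odd_overpartitions_def)
  qed
  moreover have "inj_on (\<lambda>(\<xi>, \<xi>s). \<xi> # \<xi>s) (\<Union>i\<in>{0..n}. ?S i)"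
    by (auto intro!: inj_onI)
  ultimately have "OPT (Suc k) n = card (\<Union>i\<in>{0..n}. ?S i)"
    by (simp add: OPT_def card_image)
  also have "\<dots> = (\<Sum>i=0..n. card (?S i))"
    by (rule card_UN_disjoint)
      (auto simp: finite_odd_overpartitions finite_opt_tuples, auto simp: odd_overpartitions_def)
  finally show ?thesis
    by (simp add: card_cartesian_product OPT_def)
qed

definition overpartition_gf :: "int fps" where
  "overpartition_gf = Abs_fps (\<lambda>n. int (card (odd_overpartitions n)))"

lemma OPT_gf: "Abs_fps (\<lambda>n. int (OPT k n)) = overpartition_gf ^ k"
proof (induction k)
  case 0
  show ?case by (rule fps_ext) (simp add: OPT_0)
next
  case (Suc k)
  have "Abs_fps (\<lambda>n. int (OPT (Suc k) n)) = overpartition_gf * Abs_fps (\<lambda>n. int (OPT k n))"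
    by (rule fps_ext) (simp add: OPT_Suc fps_mult_nth overpartition_gf_def)
  then show ?case
    by (simp add: Suc.IH)
qed

section \<open>Odd powers of the generating function modulo 4\<close>

lemma overpartition_gf_square: "\<exists>X. overpartition_gf ^ 2 = 1 + 4 * X"
proof -
  \<comment> \<open>The constant term of the generating function is 1, and all later coefficients
    are even, so the halving is exact.\<close>
  define H where "H = Abs_fps (\<lambda>n. if n = 0 then 0 else int (card (odd_overpartitions n)) div 2)"
  have "overpartition_gf = 1 + 2 * H"
    by (rule fps_ext)
      (use even_card_odd_overpartitions in
        \<open>auto simp: overpartition_gf_def H_def card_odd_overpartitions_0 numeral_fps_const\<close>)
  then have "overpartition_gf ^ 2 = (1 + 2 * H) ^ 2"
    by simp
  also have "\<dots> = 1 + 4 * (H + H ^ 2)"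
    by (simp add: algebra_simps power2_eq_square)
  finally have "overpartition_gf ^ 2 = 1 + 4 * (H + H ^ 2)" .
  then show ?thesis ..
qed

lemma overpartition_gf_odd_power:
  "\<exists>Y. overpartition_gf ^ (2 * k + 1) = overpartition_gf + 4 * Y"
proof (induction k)
  case 0
  show ?case by (intro exI[of _ 0]) simp
next
  case (Suc k)
  then obtain Y where Y: "overpartition_gf ^ (2 * k + 1) = overpartition_gf + 4 * Y" ..
  obtain X where X: "overpartition_gf ^ 2 = 1 + 4 * X"
    using overpartition_gf_square ..
  have "overpartition_gf ^ (2 * Suc k + 1) = overpartition_gf ^ 2 * overpartition_gf ^ (2 * k + 1)"
    by (simp add: power2_eq_square mult.assoc)
  \<comment> \<open>The new witness comes from expanding
    \<open>(1 + 4 * X) * (overpartition_gf + 4 * Y)\<close>.\<close>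
  also have "\<dots> = overpartition_gf + 4 * (X * overpartition_gf + Y + 4 * X * Y)"
    by (simp only: X Y) (simp add: algebra_simps)
  finally show ?case ..
qed

lemma OPT_odd_cong: "[OPT (2 * k + 1) n = card (odd_overpartitions n)] (mod 4)"
proof -
  obtain Y where Y: "overpartition_gf ^ (2 * k + 1) = overpartition_gf + 4 * Y"
    using overpartition_gf_odd_power by blast
  have "int (OPT (2 * k + 1) n) = fps_nth (overpartition_gf ^ (2 * k + 1)) n"
    by (simp only: OPT_gf[symmetric] fps_nth_Abs_fps)
  also have "\<dots> = int (card (odd_overpartitions n)) + 4 * fps_nth Y n"
    unfolding Y by (simp add: overpartition_gf_def numeral_fps_const)
  finally have "[int (OPT (2 * k + 1) n) = int (card (odd_overpartitions n))] (mod int 4)"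
    by (simp add: cong_def)
  then show ?thesis
    by (simp only: cong_int_iff)
qed

theorem theorem2p9:
  fixes n k p r R :: nat
  assumes "prime p" and "p \<ge> 5"
    and "1 \<le> r" and "r \<le> p - 1"
    and "\<not> QuadRes (int p) (int r)"
    and "R = (if odd r then r else p + r)"
  shows "[OPT (2 * k + 1) (2 * p * n + R) = 0] (mod 4)"
proof -
  let ?m = "2 * p * n + R"
  have "odd p"
    using assms(1,2) prime_odd_nat by auto
  \<comment> \<open>Adding the odd \<open>p\<close> to an even \<open>r\<close> makes
    \<open>R\<close> odd while keeping its residue modulo \<open>p\<close>.\<close>
  then have "odd ?m"
    using assms(6) by auto
  have "?m \<noteq> x ^ 2" for x
  proof
    assume "?m = x ^ 2"
    moreover have "?m = r + (if odd r then 2 * n else 2 * n + 1) * p"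
      using assms(6) by (simp add: algebra_simps)
    then have "[?m = r] (mod p)"
      by (simp only: cong_def mod_mult_self1)
    \<comment> \<open>A square root \<open>x\<close> of \<open>?m\<close> would make
      \<open>r\<close> a quadratic residue modulo \<open>p\<close>.\<close>
    ultimately have "[int (x ^ 2) = int r] (mod int p)"
      by (simp only: cong_int_iff)
    then have "QuadRes (int p) (int r)"
      by (auto simp: QuadRes_def)
    then show False
      using assms(5) by blast
  qed
  then have "even (card {d. d dvd ?m})"
    by (rule even_card_divisors)
  then have "[2 * card {d. d dvd ?m} = 0] (mod 4)"
    by (auto simp: cong_def elim!: evenE)
  then show ?thesis
    using OPT_odd_cong card_odd_overpartitions_cong[OF \<open>odd ?m\<close>] cong_trans by blast
qed

end
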